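(* Let $E$ be an arbitrary directed graph, $K$ a field, and $L_K(E)$ the Leavitt path algebra of $E$ over $K$. Suppose $A=P_1\cdots P_m=Q_1\cdots Q_n$ are two representations of a proper two-sided ideal $A$ of $L_K(E)$ as tight products of prime ideals $P_i$ and $Q_j$. Then $m=n$ and $\{P_1,\ldots,P_m\}=\{Q_1,\ldots,Q_m\}$.
   Context: A directed graph $E=(E^0,E^1,r,s)$ consists of sets $E^0$ (vertices) and $E^1$ (edges), of arbitrary cardinality, with maps $r,s:E^1\to E^0$ (range, source). A vertex $v$ is regular if $s^{-1}(v)$ is finite and non-empty. The Leavitt path algebra $L_K(E)$ is the (not necessarily unital) $K$-algebra generated by pairwise orthogonal idempotents $\{v:v\in E^0\}$ and elements $\{e,e^*:e\in E^1\}$ subject to: (1) $s(e)e=e=er(e)$; (2) $r(e)e^*=e^*=e^*s(e)$; (3) $e^*e=r(e)$ and $e^*f=0$ for edges $e\ne f$; (4) $v=\sum_{s(e)=v}ee^*$ for every regular vertex $v$. Ideals are two-sided. A proper ideal $P$ is prime if for all two-sided ideals $A,B$, $AB\subseteq P$ implies $A\subseteq P$ or $B\subseteq P$. A product of ideals $P_1\cdots P_m$ is called tight if $P_i\nsubseteq P_j$ for all $i\ne j$. *)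

theory Defs
  imports
    "HOL-Library.Poly_Mapping"
    "HOL-Algebra.Ideal_Product"
    "HOL-Algebra.QuotRing"
    "Graph_Theory.Digraph"
begin

section \<open>Free associative algebras\<close>

text \<open>
  Words form the free monoid. Its operation is written additively because the convolution
  product of finitely supported functions in \<^theory>\<open>HOL-Library.Poly_Mapping\<close> is indexed
  by the class \<^class>\<open>monoid_add\<close>; the operation is not commutative.
\<close>

datatype 'x fword = FWord (letters: "'x list")

instantiation fword :: (type) monoid_add
begin

definition zero_fword :: "'a fword" where
  "0 = FWord []"

definition plus_fword :: "'a fword \<Rightarrow> 'a fword \<Rightarrow> 'a fword" where
  "u + w = FWord (letters u @ letters w)"

instance
  by standard (auto simp: zero_fword_def plus_fword_def)

end

text \<open>The unital free algebra on the set \<open>X\<close>: noncommutative polynomials with letters in \<open>X\<close>.\<close>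

definition free_algebra :: "'x set \<Rightarrow> ('x fword \<Rightarrow>\<^sub>0 'k::field) ring" where
  "free_algebra X =
     \<lparr>carrier = {f. \<forall>w\<in>Poly_Mapping.keys f. set (letters w) \<subseteq> X},
      mult = (*), one = 1, zero = 0, add = (+)\<rparr>"

text \<open>Its augmentation ideal, which is the free non-unital algebra on \<open>X\<close>.\<close>

definition free_algebra_aug :: "'x set \<Rightarrow> ('x fword \<Rightarrow>\<^sub>0 'k::field) set" where
  "free_algebra_aug X = {f \<in> carrier (free_algebra X). Poly_Mapping.lookup f 0 = 0}"

definition letter :: "'x \<Rightarrow> 'x fword \<Rightarrow>\<^sub>0 'k::field" where
  "letter x = Poly_Mapping.single (FWord [x]) 1"


section \<open>Leavitt path algebras\<close>

text \<open>
  A directed graph is a \<^typ>\<open>('v, 'e) pre_digraph\<close> satisfying \<^const>\<open>wf_digraph\<close>; the source and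
  range maps are \<^const>\<open>tail\<close> and \<^const>\<open>head\<close>.
\<close>

datatype ('v, 'e) leavitt_gen = Vertex 'v | Edge 'e | Ghost 'e

type_synonym ('v, 'e, 'k) leavitt_poly = "('v, 'e) leavitt_gen fword \<Rightarrow>\<^sub>0 'k"

definition leavitt_gens :: "('v, 'e) pre_digraph \<Rightarrow> ('v, 'e) leavitt_gen set" where
  "leavitt_gens E = Vertex ` verts E \<union> Edge ` arcs E \<union> Ghost ` arcs E"

definition regular_vertex :: "('v, 'e) pre_digraph \<Rightarrow> 'v \<Rightarrow> bool" where
  "regular_vertex E v \<longleftrightarrow> v \<in> verts E \<and> finite (out_arcs E v) \<and> out_arcs E v \<noteq> {}"

definition leavitt_rels :: "('v, 'e) pre_digraph \<Rightarrow> ('v, 'e, 'k::field) leavitt_poly set" where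
  "leavitt_rels E =
     {letter (Vertex v) * letter (Vertex w) - (if v = w then letter (Vertex v) else 0) | v w.
        v \<in> verts E \<and> w \<in> verts E}
   \<union> {letter (Vertex (tail E e)) * letter (Edge e) - letter (Edge e) | e. e \<in> arcs E}
   \<union> {letter (Edge e) * letter (Vertex (head E e)) - letter (Edge e) | e. e \<in> arcs E}
   \<union> {letter (Vertex (head E e)) * letter (Ghost e) - letter (Ghost e) | e. e \<in> arcs E}
   \<union> {letter (Ghost e) * letter (Vertex (tail E e)) - letter (Ghost e) | e. e \<in> arcs E}
   \<union> {letter (Ghost e) * letter (Edge f) - (if e = f then letter (Vertex (head E e)) else 0) | e f.
        e \<in> arcs E \<and> f \<in> arcs E}
   \<union> {letter (Vertex v) - (\<Sum>e\<in>out_arcs E v. letter (Edge e) * letter (Ghost e)) | v.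
        regular_vertex E v}"

definition leavitt_ideal :: "('v, 'e) pre_digraph \<Rightarrow> ('v, 'e, 'k::field) leavitt_poly set" where
  "leavitt_ideal E = Idl\<^bsub>free_algebra (leavitt_gens E)\<^esub> (leavitt_rels E)"

text \<open>
  All relations have zero constant term, and an ideal of the unital free algebra is closed under
  scalars. So the cosets of the augmentation ideal form the quotient of the free non-unital algebra
  by the algebra ideal generated by the relations. The field \<open>one\<close> inherited from the unital
  quotient is irrelevant: it need not lie in the carrier, and nothing below refers to it.
\<close>

definition leavitt_path_algebra ::
    "('v, 'e) pre_digraph \<Rightarrow> ('v, 'e, 'k::field) leavitt_poly set ring" where
  "leavitt_path_algebra E =
     (free_algebra (leavitt_gens E) Quot leavitt_ideal E)
       \<lparr>carrier := (\<lambda>f. leavitt_ideal E +>\<^bsub>free_algebra (leavitt_gens E)\<^esub> f)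
                    ` free_algebra_aug (leavitt_gens E)\<rparr>"


section \<open>Ideals of not necessarily unital rings\<close>

text \<open>
  \<^const>\<open>ideal\<close> and \<^const>\<open>primeideal\<close> require a unital (respectively commutative) ring, so
  they do not apply. \<^const>\<open>ideal_prod\<close> is the set of nonempty finite sums of products and
  needs no unit.
\<close>

definition rng_ideal :: "'a set \<Rightarrow> ('a, 'b) ring_scheme \<Rightarrow> bool" where
  "rng_ideal I R \<longleftrightarrow> additive_subgroup I R \<and>
     (\<forall>a\<in>I. \<forall>x\<in>carrier R. x \<otimes>\<^bsub>R\<^esub> a \<in> I \<and> a \<otimes>\<^bsub>R\<^esub> x \<in> I)"

definition rng_prime_ideal :: "'a set \<Rightarrow> ('a, 'b) ring_scheme \<Rightarrow> bool" where
  "rng_prime_ideal P R \<longleftrightarrow> rng_ideal P R \<and> P \<noteq> carrier R \<and>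
     (\<forall>A B. rng_ideal A R \<longrightarrow> rng_ideal B R \<longrightarrow> A \<cdot>\<^bsub>R\<^esub> B \<subseteq> P \<longrightarrow> A \<subseteq> P \<or> B \<subseteq> P)"

text \<open>The product of a singleton list is the ideal itself, and the empty product is the whole ring.\<close>

fun ideal_list_prod :: "('a, 'b) ring_scheme \<Rightarrow> 'a set list \<Rightarrow> 'a set" where
  "ideal_list_prod R [] = carrier R"
| "ideal_list_prod R [P] = P"
| "ideal_list_prod R (P # Q # Ps) = P \<cdot>\<^bsub>R\<^esub> ideal_list_prod R (Q # Ps)"

definition tight :: "'a set list \<Rightarrow> bool" where
  "tight Ps \<longleftrightarrow> (\<forall>i<length Ps. \<forall>j<length Ps. i \<noteq> j \<longrightarrow> \<not> Ps ! i \<subseteq> Ps ! j)"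


section \<open>Basic facts\<close>

lemma keys_times_letters:
  assumes "w \<in> Poly_Mapping.keys (f * g)"
  obtains u v where "u \<in> Poly_Mapping.keys f" "v \<in> Poly_Mapping.keys g" "w = u + v"
  using assms keys_mult[of f g] by blast

lemma ring_free_algebra: "ring (free_algebra X :: ('x fword \<Rightarrow>\<^sub>0 'k::field) ring)"
proof (rule ringI)
  let ?F = "free_algebra X :: ('x fword \<Rightarrow>\<^sub>0 'k) ring"
  show "abelian_group ?F"
  proof (rule abelian_groupI)
    fix f assume f: "f \<in> carrier ?F"
    then show "\<exists>g\<in>carrier ?F. g \<oplus>\<^bsub>?F\<^esub> f = \<zero>\<^bsub>?F\<^esub>"
      by (intro bexI[of _ "- f"]) (auto simp: free_algebra_def)
  next
    fix f g assume "f \<in> carrier ?F" "g \<in> carrier ?F"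
    then show "f \<oplus>\<^bsub>?F\<^esub> g \<in> carrier ?F"
      using Poly_Mapping.keys_add[of f g] by (fastforce simp: free_algebra_def)
  qed (auto simp: free_algebra_def ac_simps)
  show "monoid ?F"
  proof (rule monoidI)
    fix f g assume "f \<in> carrier ?F" "g \<in> carrier ?F"
    then show "f \<otimes>\<^bsub>?F\<^esub> g \<in> carrier ?F"
      by (fastforce simp: free_algebra_def plus_fword_def elim!: keys_times_letters)
  qed (auto simp: free_algebra_def mult.assoc zero_fword_def)
qed (auto simp: free_algebra_def distrib_left distrib_right)

lemma letter_closed: "x \<in> X \<Longrightarrow> letter x \<in> carrier (free_algebra X)"
  by (auto simp: free_algebra_def letter_def)

lemma lookup_times_zero:
  fixes f g :: "'x fword \<Rightarrow>\<^sub>0 'k::field"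
  assumes "Poly_Mapping.lookup f 0 = 0"
  shows "Poly_Mapping.lookup (f * g) 0 = 0" "Poly_Mapping.lookup (g * f) 0 = 0"
proof -
  have zero_iff: "u = 0 \<and> v = 0" if "0 = u + v" for u v :: "'x fword"
    using that by (cases u; cases v) (auto simp: zero_fword_def plus_fword_def)
  have "0 \<notin> Poly_Mapping.keys f"
    using assms by (simp add: in_keys_iff)
  then have "0 \<notin> Poly_Mapping.keys (f * g)" "0 \<notin> Poly_Mapping.keys (g * f)"
    by (auto elim!: keys_times_letters dest: zero_iff)
  then show "Poly_Mapping.lookup (f * g) 0 = 0" "Poly_Mapping.lookup (g * f) 0 = 0"
    by (simp_all add: in_keys_iff)
qed

lemma free_algebra_aug_ideal: "ideal (free_algebra_aug X) (free_algebra X)"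
proof -
  interpret F: ring "free_algebra X" by (rule ring_free_algebra)
  have neg: "\<ominus>\<^bsub>free_algebra X\<^esub> f = - f" if "f \<in> carrier (free_algebra X)" for f
    by (rule F.minus_equality) (use that in \<open>auto simp: free_algebra_def\<close>)
  have add: "f + g \<in> carrier (free_algebra X)"
    if "f \<in> carrier (free_algebra X)" "g \<in> carrier (free_algebra X)" for f g
    using F.add.m_closed[OF that] by (simp add: free_algebra_def)
  have mult: "f * g \<in> carrier (free_algebra X)"
    if "f \<in> carrier (free_algebra X)" "g \<in> carrier (free_algebra X)" for f g
    using F.m_closed[OF that] by (simp add: free_algebra_def)
  have add_eq: "(\<oplus>\<^bsub>free_algebra X\<^esub>) = (+)" "(\<otimes>\<^bsub>free_algebra X\<^esub>) = (*)" "\<zero>\<^bsub>free_algebra X\<^esub> = 0"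
    by (simp_all add: free_algebra_def)
  show ?thesis
  proof (rule idealI)
    show "subgroup (free_algebra_aug X) (add_monoid (free_algebra X))"
    proof (rule group.subgroupI[OF F.a_group])
      show "free_algebra_aug X \<noteq> {}"
        using F.zero_closed by (auto simp: free_algebra_aug_def add_eq)
      fix f assume f: "f \<in> free_algebra_aug X"
      then have "- f \<in> carrier (free_algebra X)" by (auto simp: free_algebra_aug_def free_algebra_def)
      then show "inv\<^bsub>add_monoid (free_algebra X)\<^esub> f \<in> free_algebra_aug X"
        using f neg[of f] by (auto simp: free_algebra_aug_def a_inv_def)
    qed (auto simp: free_algebra_aug_def add add_eq lookup_add)
  qed (auto simp: free_algebra_aug_def add_eq mult lookup_times_zero intro: ring_free_algebra)
qed

lemma letter_aug:
  assumes "x \<in> X"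
  shows "letter x \<in> free_algebra_aug X"
proof -
  have "FWord [x] \<noteq> 0"
    by (simp add: zero_fword_def)
  then have "Poly_Mapping.lookup (letter x) 0 = 0"
    unfolding letter_def by (rule lookup_single_not_eq)
  then show ?thesis
    using letter_closed[OF assms] unfolding free_algebra_aug_def by blast
qed

lemma leavitt_rels_aug:
  assumes "wf_digraph E"
  shows "(leavitt_rels E :: ('v, 'e, 'k::field) leavitt_poly set)
           \<subseteq> free_algebra_aug (leavitt_gens E)"
proof -
  let ?F = "free_algebra (leavitt_gens E) :: ('v, 'e, 'k) leavitt_poly ring"
  define B where "B = (free_algebra_aug (leavitt_gens E) :: ('v, 'e, 'k) leavitt_poly set)"
  interpret E: wf_digraph E by fact
  interpret I: ideal B ?F unfolding B_def by (rule free_algebra_aug_ideal)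
  have L: "letter x \<in> B" if "x \<in> leavitt_gens E" for x
    unfolding B_def using that by (rule letter_aug)
  have M: "f * g \<in> B" if "f \<in> B" "g \<in> B" for f g
    using I.I_l_closed[OF that(2) subsetD[OF I.a_subset that(1)]] by (simp add: free_algebra_def)
  have Z: "0 \<in> B"
    by (auto simp: B_def free_algebra_aug_def free_algebra_def)
  have A: "f + g \<in> B" if "f \<in> B" "g \<in> B" for f g
    using additive_subgroup.a_closed[OF I.is_additive_subgroup that] by (simp add: free_algebra_def)
  have N: "- f \<in> B" if "f \<in> B" for f
    using that by (auto simp: B_def free_algebra_aug_def free_algebra_def)
  have D: "f - g \<in> B" if "f \<in> B" "g \<in> B" for f g
    using A[OF that(1) N[OF that(2)]] by simp
  have S: "(\<Sum>e\<in>C. h e) \<in> B" if "\<And>e. e \<in> C \<Longrightarrow> h e \<in> B" for C :: "'e set" and h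
    using that by (induction C rule: infinite_finite_induct) (simp_all add: A Z)
  have V: "letter (Vertex v) \<in> B" if "v \<in> verts E" for v
    using that by (intro L) (simp add: leavitt_gens_def)
  have EG: "letter (Edge e) \<in> B" "letter (Ghost e) \<in> B" if "e \<in> arcs E" for e
    using that by (auto intro!: L simp: leavitt_gens_def)
  have W: "letter (Vertex (tail E e)) \<in> B" "letter (Vertex (head E e)) \<in> B" if "e \<in> arcs E" for e
    using that by (simp_all add: V)
  have "(\<Sum>e\<in>out_arcs E v. letter (Edge e) * letter (Ghost e)) \<in> B" for v
    by (intro S M) (simp_all add: EG)
  then have "leavitt_rels E \<subseteq> B"
    unfolding leavitt_rels_def regular_vertex_def
    by (auto intro!: D M Z V W EG)
  then show ?thesis by (simp add: B_def)
qed

lemma leavitt_ideal_ideal: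
  assumes "wf_digraph E"
  shows "ideal (leavitt_ideal E) (free_algebra (leavitt_gens E))"
proof -
  interpret F: ring "free_algebra (leavitt_gens E)" by (rule ring_free_algebra)
  show ?thesis
    unfolding leavitt_ideal_def
    by (rule F.genideal_ideal) (use leavitt_rels_aug[OF assms] in \<open>auto simp: free_algebra_aug_def\<close>)
qed

text \<open>The carrier is a two-sided ideal of the unital quotient, hence a ring without unit.\<close>

lemma leavitt_path_algebra_ideal:
  assumes "wf_digraph E"
  shows "ideal (carrier (leavitt_path_algebra E))
           (free_algebra (leavitt_gens E) Quot leavitt_ideal E)"
  using ring.ring_ideal_imp_quot_ideal[OF ring_free_algebra leavitt_ideal_ideal[OF assms]
      free_algebra_aug_ideal]
  by (simp add: leavitt_path_algebra_def)

end

theory Submission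
  imports Defs
begin

text \<open>
  A prime ideal that contains a product of ideals contains one of the factors, and a product of
  ideals is contained in each factor. So every \<open>Q\<^sub>j\<close> contains some \<open>P\<^sub>i\<close>, which in turn
  contains some \<open>Q\<^sub>k\<close>; tightness forces \<open>k = j\<close>, hence \<open>P\<^sub>i = Q\<^sub>j\<close>. Nothing specific
  to Leavitt path algebras is used.
\<close>

text \<open>The ring axioms without a unit: a Leavitt path algebra is unital only when its graph has
  finitely many vertices.\<close>

locale rng = abelian_group R for R (structure) +
  assumes m_closed [intro, simp]: "\<lbrakk>x \<in> carrier R; y \<in> carrier R\<rbrakk> \<Longrightarrow> x \<otimes> y \<in> carrier R"
    and m_assoc: "\<lbrakk>x \<in> carrier R; y \<in> carrier R; z \<in> carrier R\<rbrakk>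
      \<Longrightarrow> (x \<otimes> y) \<otimes> z = x \<otimes> (y \<otimes> z)"
    and l_distr: "\<lbrakk>x \<in> carrier R; y \<in> carrier R; z \<in> carrier R\<rbrakk>
      \<Longrightarrow> (x \<oplus> y) \<otimes> z = x \<otimes> z \<oplus> y \<otimes> z"
    and r_distr: "\<lbrakk>x \<in> carrier R; y \<in> carrier R; z \<in> carrier R\<rbrakk>
      \<Longrightarrow> z \<otimes> (x \<oplus> y) = z \<otimes> x \<oplus> z \<otimes> y"

lemma rng_idealD:
  assumes "rng_ideal I R"
  shows "I \<subseteq> carrier R"
    and "\<zero>\<^bsub>R\<^esub> \<in> I"
    and "\<lbrakk>a \<in> I; b \<in> I\<rbrakk> \<Longrightarrow> a \<oplus>\<^bsub>R\<^esub> b \<in> I"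
    and "\<lbrakk>a \<in> I; x \<in> carrier R\<rbrakk> \<Longrightarrow> x \<otimes>\<^bsub>R\<^esub> a \<in> I"
    and "\<lbrakk>a \<in> I; x \<in> carrier R\<rbrakk> \<Longrightarrow> a \<otimes>\<^bsub>R\<^esub> x \<in> I"
  using assms
  by (auto simp: rng_ideal_def dest: additive_subgroup.a_subset additive_subgroup.zero_closed
      additive_subgroup.a_closed)

lemma rng_ideal_uminus:
  "\<lbrakk>rng_ideal I R; a \<in> I\<rbrakk> \<Longrightarrow> \<ominus>\<^bsub>R\<^esub> a \<in> I"
  unfolding rng_ideal_def a_inv_def
  by (auto dest: additive_subgroup.a_subgroup subgroup.m_inv_closed)

lemma ideal_prod_le:
  assumes "rng_ideal I R" and "rng_ideal J R"
  shows "I \<cdot>\<^bsub>R\<^esub> J \<subseteq> I" and "I \<cdot>\<^bsub>R\<^esub> J \<subseteq> J"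
proof -
  have "x \<in> I \<and> x \<in> J" if "x \<in> I \<cdot>\<^bsub>R\<^esub> J" for x
    using that
  proof (induction rule: ideal_prod.induct)
    case (prod i j)
    then show ?case
      using rng_idealD(1,5)[OF assms(1)] rng_idealD(1,4)[OF assms(2)] by (simp add: subset_iff)
  next
    case (sum s1 s2)
    then show ?case
      using rng_idealD(3)[OF assms(1)] rng_idealD(3)[OF assms(2)] by simp
  qed
  then show "I \<cdot>\<^bsub>R\<^esub> J \<subseteq> I" and "I \<cdot>\<^bsub>R\<^esub> J \<subseteq> J"
    by auto
qed

text \<open>A repeated entry would be contained in itself at two different indices. Distinctness
  later turns equality of the sets of factors into equality of their number.\<close>

lemma tight_distinct: "tight Ps \<Longrightarrow> distinct Ps"
  by (auto simp: tight_def distinct_conv_nth)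

lemma tightD: "\<lbrakk>tight Ps; P \<in> set Ps; Q \<in> set Ps; P \<subseteq> Q\<rbrakk> \<Longrightarrow> P = Q"
  unfolding tight_def in_set_conv_nth by metis

context rng
begin

lemma rng_ideal_carrier: "rng_ideal (carrier R) R"
  by (auto simp: rng_ideal_def additive_subgroup_def add.subgroup_self)

text \<open>Needed because \<open>ideal_prod\<close> is generated by products and sums alone, so its
  closure under negatives has to come from moving the sign into a factor.\<close>

lemma minus_mult_left:
  assumes [simp]: "x \<in> carrier R" "y \<in> carrier R"
  shows "(\<ominus> x) \<otimes> y = \<ominus> (x \<otimes> y)"
proof -
  \<comment> \<open>An element that equals its own double is zero, by additive cancellation.\<close>
  have "\<zero> \<otimes> y \<oplus> \<zero> \<otimes> y = \<zero> \<otimes> y"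
    using l_distr[of \<zero> \<zero> y] by simp
  then have "\<zero> \<otimes> y = \<zero>"
    by (metis add.l_cancel_one' assms(2) m_closed zero_closed)
  then have "(\<ominus> x) \<otimes> y \<oplus> x \<otimes> y = \<zero>"
    using l_distr[of "\<ominus> x" x y] by (simp add: l_neg)
  then show ?thesis
    by (simp add: minus_equality)
qed

text \<open>On a generator \<open>i \<otimes> j\<close>, the sign and left multipliers are absorbed
  by \<open>i\<close>, right multipliers by \<open>j\<close>. Distributivity carries this over to
  sums.\<close>

lemma rng_ideal_prod:
  assumes I: "rng_ideal I R" and J: "rng_ideal J R"
  shows "rng_ideal (I \<cdot> J) R"
proof -
  note ID = rng_idealD[OF I] and JD = rng_idealD[OF J]
  have sub: "I \<cdot> J \<subseteq> carrier R"
    using ideal_prod_le(1)[OF I J] ID(1) by blast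
  have neg: "\<ominus> a \<in> I \<cdot> J" if "a \<in> I \<cdot> J" for a
    using that
  proof (induction rule: ideal_prod.induct)
    case (prod i j)
    then have "(\<ominus> i) \<otimes> j \<in> I \<cdot> J"
      by (intro ideal_prod.prod rng_ideal_uminus[OF I])
    moreover have "i \<in> carrier R" "j \<in> carrier R"
      using prod ID(1) JD(1) by auto
    ultimately show ?case
      by (simp add: minus_mult_left)
  next
    case (sum s1 s2)
    moreover have "s1 \<in> carrier R" "s2 \<in> carrier R"
      using sum sub by auto
    ultimately show ?case
      by (simp add: minus_add ideal_prod.sum)
  qed
  have mult: "x \<otimes> a \<in> I \<cdot> J \<and> a \<otimes> x \<in> I \<cdot> J" if "a \<in> I \<cdot> J" and x: "x \<in> carrier R" for a x
    using that(1)
  proof (induction rule: ideal_prod.induct)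
    case (prod i j)
    then have "i \<in> carrier R" "j \<in> carrier R"
      using ID(1) JD(1) by auto
    then have "x \<otimes> (i \<otimes> j) = (x \<otimes> i) \<otimes> j" "(i \<otimes> j) \<otimes> x = i \<otimes> (j \<otimes> x)"
      using x by (simp_all add: m_assoc)
    then show ?case
      using prod ID(4) JD(5) x by (auto intro: ideal_prod.prod)
  next
    case (sum s1 s2)
    moreover have "s1 \<in> carrier R" "s2 \<in> carrier R"
      using sum sub by auto
    ultimately show ?case
      using x by (simp add: l_distr r_distr ideal_prod.sum)
  qed
  have "subgroup (I \<cdot> J) (add_monoid R)"
  proof (rule add.subgroupI)
    show "I \<cdot> J \<noteq> {}"
      using ideal_prod.prod[OF ID(2) JD(2)] by blast
  qed (use sub neg in \<open>auto simp: a_inv_def intro: ideal_prod.sum\<close>)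
  then show ?thesis
    using mult by (simp add: rng_ideal_def additive_subgroup_def)
qed

lemma rng_ideal_list_prod:
  assumes "\<And>P. P \<in> set Ps \<Longrightarrow> rng_ideal P R"
  shows "rng_ideal (ideal_list_prod R Ps) R"
  using assms
  by (induction Ps rule: induct_list012) (simp_all add: rng_ideal_carrier rng_ideal_prod)

text \<open>A product of two ideals lies in both, so each factor is reached by peeling off the head.
  The induction treats singletons separately, as \<open>ideal_list_prod\<close> does.\<close>

lemma ideal_list_prod_le:
  assumes "\<And>P. P \<in> set Ps \<Longrightarrow> rng_ideal P R" and "P \<in> set Ps"
  shows "ideal_list_prod R Ps \<subseteq> P"
  using assms
proof (induction Ps rule: induct_list012)
  case (3 P' Q Ps)
  have "rng_ideal P' R" and "rng_ideal (ideal_list_prod R (Q # Ps)) R"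
    using 3(3) rng_ideal_list_prod[of "Q # Ps"] by simp_all
  note le = ideal_prod_le[OF this]
  show ?case
  proof (cases "P = P'")
    case True
    then show ?thesis
      using le(1) by simp
  next
    case False
    then have "ideal_list_prod R (Q # Ps) \<subseteq> P"
      using 3(2)[OF 3(3)] 3(4) by simp
    then show ?thesis
      using le(2) by simp
  qed
qed auto

text \<open>Primeness of \<open>Q\<close>, applied to the head and the product of the tail, either
  gives the factor or passes to a shorter list.\<close>

lemma rng_prime_ideal_list_prod:
  assumes "rng_prime_ideal Q R" and "\<And>P. P \<in> set Ps \<Longrightarrow> rng_ideal P R"
    and "ideal_list_prod R Ps \<subseteq> Q"
  shows "\<exists>P\<in>set Ps. P \<subseteq> Q"
  using assms
proof (induction Ps rule: induct_list012)
  case 1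
  then show ?case
    \<comment> \<open>The empty product is the whole ring, which the proper ideal \<open>Q\<close>
      cannot contain.\<close>
    using rng_idealD(1)[of Q R] by (simp add: rng_prime_ideal_def)
next
  case (3 P' P Ps)
  have "rng_ideal P' R" and "rng_ideal (ideal_list_prod R (P # Ps)) R"
    using 3(4) rng_ideal_list_prod[of "P # Ps"] by simp_all
  then have "P' \<subseteq> Q \<or> ideal_list_prod R (P # Ps) \<subseteq> Q"
    using 3(3,5) by (simp add: rng_prime_ideal_def)
  then show ?case
    using 3(2)[OF 3(3)] 3(4) by (metis list.set_intros)
qed auto

lemma tight_prime_factors_subset:
  assumes "\<And>P. P \<in> set Ps \<Longrightarrow> rng_prime_ideal P R" and "\<And>Q. Q \<in> set Qs \<Longrightarrow> rng_prime_ideal Q R"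
    and "tight Qs" and "ideal_list_prod R Ps = ideal_list_prod R Qs"
  shows "set Qs \<subseteq> set Ps"
proof
  fix Q
  assume Q: "Q \<in> set Qs"
  have idl: "rng_ideal P R" if "P \<in> set Ps \<union> set Qs" for P
    using that assms(1,2) by (auto simp: rng_prime_ideal_def)
  obtain P where P: "P \<in> set Ps" "P \<subseteq> Q"
    using rng_prime_ideal_list_prod[of Q Ps] ideal_list_prod_le[of Qs Q] Q assms(2,4) idl
    by (metis UnCI)
  obtain Q' where Q': "Q' \<in> set Qs" "Q' \<subseteq> P"
    using rng_prime_ideal_list_prod[of P Qs] ideal_list_prod_le[of Ps P] P(1) assms(1,4) idl
    by (metis UnCI)
  \<comment> \<open>The chain \<open>Q' \<subseteq> P \<subseteq> Q\<close> has both ends among the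
    factors \<open>Qs\<close>; tightness collapses it, so that \<open>P = Q\<close> too.\<close>
  have "Q' = Q"
    using tightD[OF \<open>tight Qs\<close> Q'(1) Q] Q'(2) P(2) by blast
  then show "Q \<in> set Ps"
    using P Q' by auto
qed

end

text \<open>An ideal is closed under the operations of the ambient ring and inherits its laws. The
  field \<open>one\<close> is kept but may lie outside \<open>I\<close>, so the result is a
  \<open>rng\<close> only.\<close>

lemma ideal_imp_rng:
  assumes "ideal I S"
  shows "rng (S\<lparr>carrier := I\<rparr>)"
proof -
  interpret ideal I S by fact
  have "\<exists>y\<in>I. y \<oplus>\<^bsub>S\<^esub> x = \<zero>\<^bsub>S\<^esub>" if "x \<in> I" for x
    using that by (intro bexI[of _ "\<ominus>\<^bsub>S\<^esub> x"]) (simp_all add: l_neg)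
  then have "abelian_group (S\<lparr>carrier := I\<rparr>)"
    by (intro abelian_groupI) (simp_all add: a_ac)
  then show ?thesis
    by (rule rng.intro, intro rng_axioms.intro)
      (simp_all add: I_l_closed m_assoc l_distr r_distr)
qed

lemma rng_leavitt_path_algebra:
  assumes "wf_digraph E"
  shows "rng (leavitt_path_algebra E :: ('v, 'e, 'k::field) leavitt_poly set ring)"
  using ideal_imp_rng[OF leavitt_path_algebra_ideal[OF assms]]
  by (simp add: leavitt_path_algebra_def)

theorem proposition3p4:
  fixes E :: "('v, 'e) pre_digraph"
    and A :: "('v, 'e, 'k::field) leavitt_poly set set"
    and Ps Qs :: "('v, 'e, 'k) leavitt_poly set set list"
  assumes "wf_digraph E"
    and "rng_ideal A (leavitt_path_algebra E)"
    and "A \<noteq> carrier (leavitt_path_algebra E)"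
    and "\<And>P. P \<in> set Ps \<Longrightarrow> rng_prime_ideal P (leavitt_path_algebra E)"
    and "\<And>Q. Q \<in> set Qs \<Longrightarrow> rng_prime_ideal Q (leavitt_path_algebra E)"
    and "tight Ps" and "tight Qs"
    and "A = ideal_list_prod (leavitt_path_algebra E) Ps"
    and "A = ideal_list_prod (leavitt_path_algebra E) Qs"
  shows "length Ps = length Qs \<and> set Ps = set Qs"
proof -
  interpret rng "leavitt_path_algebra E :: ('v, 'e, 'k) leavitt_poly set ring"
    by (rule rng_leavitt_path_algebra) fact
  \<comment> \<open>The two lists exchange roles between the two inclusions.\<close>
  have "set Qs \<subseteq> set Ps" and "set Ps \<subseteq> set Qs"
    by (rule tight_prime_factors_subset; use assms in simp)+
  then have "set Ps = set Qs"
    by blast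
  then show ?thesis
    using tight_distinct[OF \<open>tight Ps\<close>] tight_distinct[OF \<open>tight Qs\<close>] by (metis distinct_card)
qed

end
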